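(* Let $\beta>0$, $p\le n$, and let $X\in\mathbb R^{n\times p}$ have full rank $p$. Let $\widetilde{G_T}(X)=\mathrm{Proj}_X^{*,\mathcal E}G_T(X)\mathrm{Proj}_X$ and $\widetilde{G_N}(X)=(\mathrm{Proj}_X^\perp)^{*,\mathcal E}G_N(X)\mathrm{Proj}_X^\perp$ be the operators associated with the $\beta$-metric $g^\beta$ (see context). Their inverses are $$\widetilde{G_T}(X)^{-1}:(\mathrm N_X\mathrm{St}_{X^\top X})^{\perp,\mathcal E}\to\mathrm T_X\mathrm{St}_{X^\top X},\quad X\Omega+\Delta\mapsto\tfrac1\beta X\Omega X^\top X+\Delta X^\top X,$$ $$\widetilde{G_N}(X)^{-1}:(\mathrm T_X\mathrm{St}_{X^\top X})^{\perp,\mathcal E}\to\mathrm N_X\mathrm{St}_{X^\top X},\quad XS\mapsto\tfrac1\beta XS\,X^\top X,$$ for all $\Omega\in\mathrm{Skew}(p)$, $\Delta\in\mathbb R^{n\times p}$ with $\Delta^\top X=0$, and $S\in\mathrm{Sym}(p)$. Consequently, for $f:\mathbb R^{n\times p}\to\mathbb R$ continuously differentiable, the tangent and normal landing directions $d_T(X)=-\mathrm{grad}^{g^\beta}_{\mathrm{St}_{X^\top X}}f(X)$ and $d_N(X)=-\mathrm Dc(X)^{\dagger,g^\beta}H(X)[c(X)]$ with $H(X)=\mathrm Dc(X)\mathrm Dc(X)^{*,g^\beta}$ read $$\begin{aligned}d_T(X)&=-\tfrac1\beta X\operatorname{skew}\big((X^\top X)^{-1}X^\top\nabla_{\mathcal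 E}f(X)\big)X^\top X-(\mathrm I_n-X(X^\top X)^{-1}X^\top)\nabla_{\mathcal E}f(X)X^\top X\\&=-\nabla_{\mathcal E}f(X)X^\top X+\tfrac1{2\beta}X\nabla_{\mathcal E}f(X)^\top X-\Big(\tfrac1{2\beta}-1\Big)X(X^\top X)^{-1}X^\top\nabla_{\mathcal E}f(X)X^\top X,\end{aligned}$$ $$d_N(X)=-\nabla_{g^\beta}\psi(X)=-\tfrac1{2\beta}X(X^\top X-\mathrm I_p)X^\top X.$$
   Context: $\mathcal E=\mathbb R^{n\times p}$ and $\mathcal F=\mathrm{Sym}(p)$ (symmetric $p\times p$ matrices) carry the Frobenius inner product $\langle X,Y\rangle=\operatorname{trace}(X^\top Y)$; $\mathrm{Skew}(p)$ is the set of skew-symmetric matrices; $\operatorname{sym}(A)=(A+A^\top)/2$, $\operatorname{skew}(A)=(A-A^\top)/2$. $c(X)=\frac12(X^\top X-\mathrm I_p)\in\mathrm{Sym}(p)$, $\psi(X)=\frac12\|c(X)\|^2$. $\nabla_{\mathcal E}f$ is the Frobenius gradient; $^{*,\mathcal E}$ the adjoint and $^{\perp,\mathcal E}$ the orthogonal complement for the Frobenius inner product. $\mathrm{St}_{X^\top X}=\{Y\in\mathbb R^{n\times p}:Y^\top Y=X^\top X\}$; $\mathrm T_X\mathrm{St}_{X^\top X}=\{\xi:\xi^\top X+X^\top\xi=0\}=\{X(X^\top X)^{-1}\Omega+\Delta:\Omega\in\mathrm{Skew}(p),\Delta^\top X=0\}$. Projectors: $\mathrm{Proj}_X[Z]=X(X^\top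 X)^{-1}\operatorname{skew}(X^\top Z)+(\mathrm I_n-X(X^\top X)^{-1}X^\top)Z$ and $\mathrm{Proj}_X^\perp[Z]=X(X^\top X)^{-1}\operatorname{sym}(X^\top Z)$; normal space $\mathrm N_X\mathrm{St}_{X^\top X}=\{X(X^\top X)^{-1}S:S\in\mathrm{Sym}(p)\}$. One has $(\mathrm T_X\mathrm{St}_{X^\top X})^{\perp,\mathcal E}=\{XS:S\in\mathrm{Sym}(p)\}$ and $(\mathrm N_X\mathrm{St}_{X^\top X})^{\perp,\mathcal E}=\{X\Omega+\Delta:\Omega\in\mathrm{Skew}(p),X^\top\Delta=0\}$. The $\beta$-metric is $g^\beta(\xi,\zeta)=\langle(\mathrm I_n-(1-\beta)X(X^\top X)^{-1}X^\top)\zeta(X^\top X)^{-1},\xi\rangle$, and its associated operators are $G_T(X)[\xi]=\big((\mathrm I_n-X(X^\top X)^{-1}X^\top)\xi+\beta X(X^\top X)^{-1}X^\top\xi\big)(X^\top X)^{-1}$ and $G_N(X)[\xi]=\beta X(X^\top X)^{-1}X^\top\xi(X^\top X)^{-1}$. The operators $\widetilde{G_T}(X)$, $\widetilde{G_N}(X)$ are regarded as maps $\mathrm T_X\mathrm{St}_{X^\top X}\to(\mathrm N_X\mathrm{St}_{X^\top X})^{\perp,\mathcal E}$ and $\mathrm N_X\mathrm{St}_{X^\top X}\to(\mathrm T_X\mathrm{St}_{X^\top X})^{\perp,\mathcal E}$. For a metric $g$: $\mathrm{grad}^g_{\mathrm{St}_{X^\top X}}f(X)$ is the unique tangent vector with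 $g(\mathrm{grad}^gf(X),\xi)=\mathrm Df(X)[\xi]$ for all tangent $\xi$; $\nabla_g\psi(X)\in\mathbb R^{n\times p}$ satisfies $g(\nabla_g\psi(X),\xi)=\mathrm D\psi(X)[\xi]$ for all $\xi\in\mathbb R^{n\times p}$; $\mathrm Dc(X)^{*,g}$ is defined by $\langle\mathrm Dc(X)[\xi],S\rangle=g(\xi,\mathrm Dc(X)^{*,g}[S])$; $\mathrm Dc(X)^{\dagger,g}=\mathrm Dc(X)^{*,g}(\mathrm Dc(X)\mathrm Dc(X)^{*,g})^{-1}$. *)

theory Defs
  imports "HOL-Analysis.Analysis"
begin

text \<open>
  A real \<open>n\<times>p\<close> matrix is an element of \<^typ>\<open>real^'p^'n\<close> (row index \<open>'n\<close>, column index \<open>'p\<close>), so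
  \<open>n = CARD('n)\<close> and \<open>p = CARD('p)\<close>. The library inner product and norm of this type are the
  Frobenius ones:
\<close>

lemma inner_matrix_eq_trace:
  fixes A B :: "real^'p^'n"
  shows "A \<bullet> B = trace (transpose A ** B)"
proof -
  have "A \<bullet> B = (\<Sum>i\<in>UNIV. \<Sum>j\<in>UNIV. A $ i $ j * B $ i $ j)"
    by (simp add: inner_vec_def)
  also have "\<dots> = (\<Sum>j\<in>UNIV. \<Sum>i\<in>UNIV. A $ i $ j * B $ i $ j)"
    by (rule sum.swap)
  also have "\<dots> = trace (transpose A ** B)"
    by (simp add: trace_def transpose_def matrix_matrix_mult_def)
  finally show ?thesis .
qed

definition sym_part :: "real^'p^'p \<Rightarrow> real^'p^'p"
  where "sym_part A = (1/2) *\<^sub>R (A + transpose A)"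

definition skew_part :: "real^'p^'p \<Rightarrow> real^'p^'p"
  where "skew_part A = (1/2) *\<^sub>R (A - transpose A)"

definition Sym_mats :: "(real^'p^'p) set"
  where "Sym_mats = {A. transpose A = A}"

definition Skew_mats :: "(real^'p^'p) set"
  where "Skew_mats = {A. transpose A = - A}"

abbreviation gram :: "real^'p^'n \<Rightarrow> real^'p^'p"
  where "gram X \<equiv> transpose X ** X"

abbreviation col_proj :: "real^'p^'n \<Rightarrow> real^'n^'n"
  where "col_proj X \<equiv> X ** matrix_inv (gram X) ** transpose X"

definition constr :: "real^'p^'n \<Rightarrow> real^'p^'p"
  where "constr X = (1/2) *\<^sub>R (gram X - mat 1)"

definition penalty :: "real^'p^'n \<Rightarrow> real"
  where "penalty X = (1/2) * (norm (constr X))\<^sup>2"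

text \<open>Tangent and normal spaces at \<open>X\<close> of \<open>{Y. Y\<^sup>T Y = X\<^sup>T X}\<close>. The normal space is the orthogonal
  complement of the tangent space for \<open>beta_metric \<beta> X\<close>, not for the Frobenius inner product.\<close>

definition tangent_St :: "real^'p^'n \<Rightarrow> (real^'p^'n) set"
  where "tangent_St X = {\<xi>. transpose \<xi> ** X + transpose X ** \<xi> = 0}"

definition normal_St :: "real^'p^'n \<Rightarrow> (real^'p^'n) set"
  where "normal_St X = {X ** matrix_inv (gram X) ** S | S. S \<in> Sym_mats}"

definition proj_tangent :: "real^'p^'n \<Rightarrow> real^'p^'n \<Rightarrow> real^'p^'n"
  where "proj_tangent X Z =
    X ** matrix_inv (gram X) ** skew_part (transpose X ** Z) + (mat 1 - col_proj X) ** Z"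

definition proj_normal :: "real^'p^'n \<Rightarrow> real^'p^'n \<Rightarrow> real^'p^'n"
  where "proj_normal X Z = X ** matrix_inv (gram X) ** sym_part (transpose X ** Z)"

definition beta_metric :: "real \<Rightarrow> real^'p^'n \<Rightarrow> real^'p^'n \<Rightarrow> real^'p^'n \<Rightarrow> real"
  where "beta_metric \<beta> X \<xi> \<zeta> =
    ((mat 1 - (1 - \<beta>) *\<^sub>R col_proj X) ** \<zeta> ** matrix_inv (gram X)) \<bullet> \<xi>"

definition G_T :: "real \<Rightarrow> real^'p^'n \<Rightarrow> real^'p^'n \<Rightarrow> real^'p^'n"
  where "G_T \<beta> X \<xi> =
    ((mat 1 - col_proj X) ** \<xi> + \<beta> *\<^sub>R (col_proj X ** \<xi>)) ** matrix_inv (gram X)"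

definition G_N :: "real \<Rightarrow> real^'p^'n \<Rightarrow> real^'p^'n \<Rightarrow> real^'p^'n"
  where "G_N \<beta> X \<xi> = \<beta> *\<^sub>R (col_proj X ** \<xi> ** matrix_inv (gram X))"

definition G_T_tilde :: "real \<Rightarrow> real^'p^'n \<Rightarrow> real^'p^'n \<Rightarrow> real^'p^'n"
  where "G_T_tilde \<beta> X = adjoint (proj_tangent X) \<circ> G_T \<beta> X \<circ> proj_tangent X"

definition G_N_tilde :: "real \<Rightarrow> real^'p^'n \<Rightarrow> real^'p^'n \<Rightarrow> real^'p^'n"
  where "G_N_tilde \<beta> X = adjoint (proj_normal X) \<circ> G_N \<beta> X \<circ> proj_normal X"

definition cont_differentiable :: "('a::real_normed_vector \<Rightarrow> 'b::real_normed_vector) \<Rightarrow> bool"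
  where "cont_differentiable f \<longleftrightarrow>
    (\<exists>f' :: 'a \<Rightarrow> 'a \<Rightarrow>\<^sub>L 'b. (\<forall>x. (f has_derivative blinfun_apply (f' x)) (at x)) \<and>
      continuous_on UNIV f')"

definition frob_grad :: "(real^'p^'n \<Rightarrow> real) \<Rightarrow> real^'p^'n \<Rightarrow> real^'p^'n"
  where "frob_grad f X = (THE G. GDERIV f X :> G)"

text \<open>Below, \<open>g X \<xi> \<zeta>\<close> is the value at \<open>X\<close> of a metric on the ambient matrix space.\<close>

definition riem_grad_St ::
    "(real^'p^'n \<Rightarrow> real^'p^'n \<Rightarrow> real^'p^'n \<Rightarrow> real) \<Rightarrow> (real^'p^'n \<Rightarrow> real) \<Rightarrow> real^'p^'n \<Rightarrow> real^'p^'n"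
  where "riem_grad_St g f X =
    (THE \<eta>. \<eta> \<in> tangent_St X \<and> (\<forall>\<xi>\<in>tangent_St X. g X \<eta> \<xi> = frechet_derivative f (at X) \<xi>))"

definition metric_grad ::
    "(real^'p^'n \<Rightarrow> real^'p^'n \<Rightarrow> real^'p^'n \<Rightarrow> real) \<Rightarrow> (real^'p^'n \<Rightarrow> real) \<Rightarrow> real^'p^'n \<Rightarrow> real^'p^'n"
  where "metric_grad g f X = (THE \<eta>. \<forall>\<xi>. g X \<eta> \<xi> = frechet_derivative f (at X) \<xi>)"

text \<open>\<open>Dc(X)\<close> takes values in the symmetric matrices, and its \<open>g\<close>-adjoint and
  \<open>H(X) = Dc(X) Dc(X)\<^sup>*\<close> are operators with domain \<^const>\<open>Sym_mats\<close>; since \<open>Sym_mats\<close> is not a type,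
  they are total functions here, and only their values on \<open>Sym_mats\<close> matter. In particular the inverse
  of \<open>H(X)\<close> is that of its restriction to \<open>Sym_mats\<close>.\<close>

definition D_constr :: "real^'p^'n \<Rightarrow> real^'p^'n \<Rightarrow> real^'p^'p"
  where "D_constr X = frechet_derivative constr (at X)"

definition D_constr_adj ::
    "(real^'p^'n \<Rightarrow> real^'p^'n \<Rightarrow> real^'p^'n \<Rightarrow> real) \<Rightarrow> real^'p^'n \<Rightarrow> real^'p^'p \<Rightarrow> real^'p^'n"
  where "D_constr_adj g X S = (THE \<eta>. \<forall>\<xi>. D_constr X \<xi> \<bullet> S = g X \<xi> \<eta>)"

definition H_op ::
    "(real^'p^'n \<Rightarrow> real^'p^'n \<Rightarrow> real^'p^'n \<Rightarrow> real) \<Rightarrow> real^'p^'n \<Rightarrow> real^'p^'p \<Rightarrow> real^'p^'p"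
  where "H_op g X = D_constr X \<circ> D_constr_adj g X"

definition D_constr_pinv ::
    "(real^'p^'n \<Rightarrow> real^'p^'n \<Rightarrow> real^'p^'n \<Rightarrow> real) \<Rightarrow> real^'p^'n \<Rightarrow> real^'p^'p \<Rightarrow> real^'p^'n"
  where "D_constr_pinv g X = D_constr_adj g X \<circ> the_inv_into Sym_mats (H_op g X)"

definition landing_T :: "real \<Rightarrow> (real^'p^'n \<Rightarrow> real) \<Rightarrow> real^'p^'n \<Rightarrow> real^'p^'n"
  where "landing_T \<beta> f X = - riem_grad_St (beta_metric \<beta>) f X"

definition landing_N :: "real \<Rightarrow> real^'p^'n \<Rightarrow> real^'p^'n"
  where "landing_N \<beta> X = - D_constr_pinv (beta_metric \<beta>) X (H_op (beta_metric \<beta>) X (constr X))"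

end

theory Submission
  imports Defs
begin

text \<open>
  Write \<open>M = X\<^sup>T X\<close>, which is invertible as \<open>X\<close> has full column rank, and \<open>P = X M\<^sup>-\<^sup>1 X\<^sup>T\<close>. The Frobenius
  adjoints of the two projectors are \<open>W \<mapsto> X skew(M\<^sup>-\<^sup>1 X\<^sup>T W) + (I - P) W\<close> and
  \<open>W \<mapsto> X sym(M\<^sup>-\<^sup>1 X\<^sup>T W)\<close>, and these fix the images of the tangent and the normal space under \<open>G_T\<close> and
  \<open>G_N\<close>. Hence on those spaces both sandwiched operators coincide with the operator
  \<open>W \<mapsto> (I - (1 - \<beta>) P) W M\<^sup>-\<^sup>1\<close> that represents the metric, whose inverse is
  \<open>W \<mapsto> (1/\<beta>) P W M + (I - P) W M\<close>. All gradients and adjoints for the metric are obtained by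
  applying this inverse to their Frobenius counterparts, for the tangential gradient after
  projecting onto \<open>(N\<^sub>X)\<^sup>\<bottom>\<close>.
\<close>

section \<open>Matrix algebra and the Frobenius inner product\<close>

lemma transpose_add: "transpose (A + B) = transpose A + transpose (B :: real^'n^'m)"
  and transpose_diff: "transpose (A - B) = transpose A - transpose (B :: real^'n^'m)"
  and transpose_uminus: "transpose (- A) = - transpose (A :: real^'n^'m)"
  and transpose_zero: "transpose (0 :: real^'n^'m) = 0"
  by (simp_all add: transpose_def vec_eq_iff)

lemma matrix_mult_diff_left: "(A - B) ** C = A ** C - B ** (C :: real^'n^'m)"
  and matrix_mult_diff_right: "D ** (C - E) = D ** C - D ** (E :: real^'n^'m)"
  and matrix_mult_uminus_left: "(- A) ** C = - (A ** (C :: real^'n^'m))"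
  and matrix_mult_uminus_right: "D ** (- C) = - (D ** (C :: real^'n^'m))"
  and matrix_mult_scaleR_left: "(c *\<^sub>R A) ** C = c *\<^sub>R (A ** (C :: real^'n^'m))"
  and matrix_mult_scaleR_right: "D ** (c *\<^sub>R C) = c *\<^sub>R (D ** (C :: real^'n^'m))"
  and matrix_mult_zero_left: "0 ** C = (0 :: real^'n^'k)"
  and matrix_mult_zero_right: "D ** (0 :: real^'n^'m) = 0"
  and matrix_mult_add_left: "(A + B) ** C = A ** C + B ** (C :: real^'n^'m)"
  by (simp_all add: matrix_matrix_mult_def vec_eq_iff sum_subtractf sum_negf sum_distrib_left
      ring_distribs sum.distrib mult_ac)

text \<open>A normal form for matrix identities: transposes reach the individual factors, products
  are distributed over sums, scalars move outwards, and products associate to the right.\<close>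

lemmas matrix_expand =
  transpose_add transpose_diff transpose_uminus transpose_zero transpose_scalar
  matrix_transpose_mul matrix_mult_diff_left matrix_mult_diff_right matrix_mult_uminus_left
  matrix_mult_uminus_right matrix_mult_scaleR_left matrix_mult_scaleR_right
  matrix_mult_zero_left matrix_mult_zero_right matrix_add_ldistrib matrix_mult_add_left
  matrix_mul_assoc[symmetric]

lemma linear_transpose: "linear (transpose :: real^'n^'m \<Rightarrow> real^'m^'n)"
  by (rule linearI) (simp_all add: matrix_expand)

lemma bounded_bilinear_matrix_mult:
  "bounded_bilinear ((**) :: real^'n^'m \<Rightarrow> real^'k^'n \<Rightarrow> real^'k^'m)"
  unfolding bilinear_conv_bounded_bilinear[symmetric] bilinear_def
  by (auto intro!: linearI simp: matrix_expand)

lemma inner_transpose: "transpose A \<bullet> transpose B = A \<bullet> (B :: real^'n^'m)"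
proof -
  have "transpose A \<bullet> transpose B = (\<Sum>i\<in>UNIV. \<Sum>j\<in>UNIV. A $ j $ i * B $ j $ i)"
    by (simp add: inner_vec_def transpose_def)
  also have "\<dots> = A \<bullet> B"
    by (subst sum.swap) (simp add: inner_vec_def)
  finally show ?thesis .
qed

lemma inner_matrix_mult_left: "(A ** B) \<bullet> C = B \<bullet> (transpose A ** (C :: real^'n^'m))"
  by (simp add: inner_matrix_eq_trace matrix_expand)

lemma inner_matrix_mult_right: "(A ** B) \<bullet> C = A \<bullet> ((C :: real^'n^'m) ** transpose B)"
proof -
  have "(A ** B) \<bullet> C = (transpose B ** transpose A) \<bullet> transpose C"
    using inner_transpose[of "A ** B" C] by (simp add: matrix_expand)
  also have "\<dots> = transpose A \<bullet> transpose (C ** transpose B)"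
    by (simp add: inner_matrix_mult_left matrix_expand)
  finally show ?thesis by (simp add: inner_transpose)
qed

section \<open>Symmetric and skew-symmetric parts\<close>

lemma sym_part_in_Sym_mats [simp]: "sym_part A \<in> Sym_mats"
  by (simp add: sym_part_def Sym_mats_def matrix_expand add.commute)

lemma skew_part_in_Skew_mats [simp]: "skew_part A \<in> Skew_mats"
  by (simp add: skew_part_def Skew_mats_def matrix_expand flip: scaleR_minus_right)

lemma sym_part_add_skew_part: "sym_part A + skew_part A = A"
  by (simp add: sym_part_def skew_part_def vec_eq_iff field_simps)

lemma sym_part_Sym: "S \<in> Sym_mats \<Longrightarrow> sym_part S = S"
  by (simp add: sym_part_def Sym_mats_def vec_eq_iff)

lemma skew_part_Skew: "\<Omega> \<in> Skew_mats \<Longrightarrow> skew_part \<Omega> = \<Omega>"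
  by (simp add: skew_part_def Skew_mats_def vec_eq_iff)

lemma inner_sym_part: "sym_part A \<bullet> B = A \<bullet> sym_part B"
  \<comment> \<open>With the second argument transposed, the invariance under transposition moves a
    transpose from one factor of the inner product to the other.\<close>
  using inner_transpose[of A "transpose B"]
  by (simp add: sym_part_def inner_add_left inner_add_right)

lemma inner_skew_part: "skew_part A \<bullet> B = A \<bullet> skew_part B"
  using inner_transpose[of A "transpose B"]
  by (simp add: skew_part_def inner_diff_left inner_diff_right)

text \<open>Identifies the Frobenius adjoint of Dc(X): \<xi> \<mapsto> sym(X^T \<xi>) as S \<mapsto>
  X sym(S).\<close>

lemma inner_mult_sym_part: "(X ** sym_part S) \<bullet> \<xi> = S \<bullet> sym_part (transpose X ** \<xi>)"
  by (simp add: inner_matrix_mult_left[of X] inner_sym_part)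

lemma inner_Sym_Skew:
  assumes "S \<in> Sym_mats" "\<Omega> \<in> Skew_mats"
  shows "S \<bullet> \<Omega> = 0"
  proof -
  have "S \<bullet> \<Omega> = transpose S \<bullet> transpose \<Omega>"
    by (rule inner_transpose[symmetric])
  also have "\<dots> = - (S \<bullet> \<Omega>)"
    using assms by (simp add: Sym_mats_def Skew_mats_def)
  finally show ?thesis by simp
qed

lemma Skew_mats_iff_orthogonal_Sym: "A \<in> Skew_mats \<longleftrightarrow> (\<forall>S\<in>Sym_mats. S \<bullet> A = 0)"
proof
  assume "\<forall>S\<in>Sym_mats. S \<bullet> A = 0"
  \<comment> \<open>The test matrix is \<open>sym_part A\<close> itself. Since taking the symmetric
    part is self-adjoint and idempotent, this inner product is the squared norm of
    \<open>sym_part A\<close>.\<close>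
  then have "sym_part A \<bullet> A = 0"
    by simp
  then have "sym_part A \<bullet> sym_part A = 0"
    by (simp add: inner_sym_part sym_part_Sym)
  then have "skew_part A = A"
    using sym_part_add_skew_part[of A] by simp
  then show "A \<in> Skew_mats"
    by (metis skew_part_in_Skew_mats)
qed (simp add: inner_Sym_Skew)

lemma inner_left_cancel:
  fixes a b :: "'a::real_inner"
  assumes "\<And>x. a \<bullet> x = b \<bullet> x"
  shows "a = b"
  proof -
  have "(a - b) \<bullet> (a - b) = 0"
    using assms[of "a - b"] by (simp add: inner_diff_left)
  then show ?thesis by simp
qed

section \<open>Derivatives of the constraint and the penalty, and the Frobenius gradient\<close>

lemma constr_in_Sym_mats: "constr X \<in> Sym_mats"
  by (simp add: constr_def Sym_mats_def matrix_expand)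

lemma has_derivative_constr:
  fixes X :: "real^'p^'n"
  shows "(constr has_derivative (\<lambda>\<xi>. sym_part (transpose X ** \<xi>))) (at X)"
proof -
  have *: "(transpose has_derivative transpose) (at X)"
    using linear_transpose
    by (intro bounded_linear_imp_has_derivative) (simp add: linear_conv_bounded_linear)
  show ?thesis
    unfolding constr_def[abs_def] sym_part_def
    by (rule derivative_eq_intros bounded_bilinear.FDERIV[OF bounded_bilinear_matrix_mult] * refl)+
      (simp add: matrix_expand)
qed

lemma D_constr_eq: "D_constr X = (\<lambda>\<xi>. sym_part (transpose X ** \<xi>))"
  unfolding D_constr_def by (rule frechet_derivative_at[symmetric]) (rule has_derivative_constr)

text \<open>By the chain rule the derivative is \<xi> \<mapsto> <c(X), Dc(X)[\<xi>]>; moving Dc(X)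
  to the other side shows that the Frobenius gradient is X c(X), because c(X) is symmetric.\<close>

lemma has_derivative_penalty:
  fixes X :: "real^'p^'n"
  shows "(penalty has_derivative (\<lambda>\<xi>. (X ** constr X) \<bullet> \<xi>)) (at X)"
proof -
  have eq: "(X ** constr X) \<bullet> \<xi> = constr X \<bullet> sym_part (transpose X ** \<xi>)" for \<xi>
    using inner_mult_sym_part[of X "constr X"] by (simp add: sym_part_Sym[OF constr_in_Sym_mats])
  show ?thesis
    unfolding penalty_def[abs_def] power2_norm_eq_inner eq
    by (rule derivative_eq_intros has_derivative_constr refl)+ (simp add: inner_commute)
qed

lemma frob_grad_works:
  fixes f :: "real^'p^'n \<Rightarrow> real"
  assumes "(f has_derivative D) (at X)"
  shows "D = (\<lambda>\<xi>. \<xi> \<bullet> frob_grad f X)"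
proof -
  have lin: "linear D"
    using assms by (rule has_derivative_linear)
  \<comment> \<open>The Riesz vector of a real-valued linear map is the image of 1 under its
    adjoint.\<close>
  define G where "G = adjoint D 1"
  have "D \<xi> = \<xi> \<bullet> G" for \<xi>
    unfolding G_def using adjoint_works[OF lin, of \<xi> 1] by simp
  then have D: "D = (\<lambda>\<xi>. \<xi> \<bullet> G)" by auto
  have "frob_grad f X = G"
    unfolding frob_grad_def
  proof (rule the_equality)
    show "GDERIV f X :> G"
      using assms D by (simp add: gderiv_def)
  next
    fix G' assume "GDERIV f X :> G'"
    then have "(\<lambda>\<xi>. \<xi> \<bullet> G') = (\<lambda>\<xi>. \<xi> \<bullet> G)"
      using has_derivative_unique[OF assms] D by (auto simp: gderiv_def)
    then show "G' = G"
      using inner_left_cancel[of G' G] by (simp add: fun_eq_iff inner_commute)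
  qed
  then show ?thesis using D by blast
qed

section \<open>The inverse Gram matrix\<close>

lemma invertible_gram:
  fixes X :: "real^'p^'n"
  assumes "rank X = CARD('p)"
  shows "invertible (gram X)"
proof -
  have "v = 0" if "gram X *v v = 0" for v
  proof -
    \<comment> \<open>The squared norm of X v is the quadratic form of X^T X at v, so the kernel of
      the Gram matrix lies in that of X, which is trivial by full rank.\<close>
    have "(X *v v) \<bullet> (X *v v) = v \<bullet> (gram X *v v)"
      by (metis dot_lmul_matrix inner_commute matrix_vector_mul_assoc transpose_matrix_vector)
    then have "X *v v = X *v 0"
      using that by simp
    then show "v = 0"
      using assms by (metis full_rank_injective injD)
  qed
  then show ?thesis
    using matrix_left_invertible_ker invertible_left_inverse by metis
qed

locale full_column_rank =
  fixes X :: "real^'p^'n" and \<beta> :: real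
  assumes full_rank: "rank X = CARD('p)"
    and beta_pos: "\<beta> > 0"
begin

abbreviation "N \<equiv> matrix_inv (gram X)"

lemma N_gram: "N ** gram X = mat 1"
  and gram_N: "gram X ** N = mat 1"
  \<comment> \<open>\<open>matrix_inv\<close> is a choice of a two-sided inverse; invertibility
    supplies the required witness.\<close>
  using someI_ex[OF invertible_gram[OF full_rank, unfolded invertible_def]]
  by (simp_all add: matrix_inv_def)

lemma transpose_N: "transpose N = N"
proof -
  \<comment> \<open>The Gram matrix is symmetric, so transposing a right inverse gives a left
    inverse, and the two must agree.\<close>
  have "transpose N ** gram X = mat 1"
    using arg_cong[OF gram_N, of transpose] by (simp add: matrix_transpose_mul)
  then have "transpose N ** gram X ** N = N"
    by simp
  then show ?thesis
    by (simp add: matrix_mul_assoc[symmetric] gram_N[unfolded matrix_mul_assoc[symmetric]])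
qed

text \<open>These forms cancel M against M^-1 inside a longer product associated to the right, where
  M does not occur as a subterm.\<close>

lemma gram_N_assoc: "transpose X ** (X ** (N ** A)) = A"
  and N_gram_assoc: "N ** (transpose X ** (X ** A)) = A"
  using gram_N N_gram by (simp_all add: matrix_mul_assoc)

lemmas matrix_simps = matrix_expand transpose_N N_gram gram_N[unfolded matrix_mul_assoc[symmetric]]
  gram_N_assoc N_gram_assoc

section \<open>Projectors, their Frobenius adjoints and the orthogonal complements\<close>

lemma tangent_St_iff: "\<xi> \<in> tangent_St X \<longleftrightarrow> transpose X ** \<xi> \<in> Skew_mats"
  by (simp add: tangent_St_def Skew_mats_def matrix_expand eq_neg_iff_add_eq_0)

text \<open>The two summands are moved across the inner product separately: the skew part is
  self-adjoint, and I - P is a symmetric matrix.\<close>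

lemma adjoint_proj_tangent:
  "adjoint (proj_tangent X) W =
    X ** skew_part (N ** transpose X ** W) + (mat 1 - col_proj X) ** W"
proof -
  have "(X ** skew_part (N ** transpose X ** W) + (mat 1 - col_proj X) ** W) \<bullet> Z =
    W \<bullet> proj_tangent X Z" for W Z
  proof -
    have 1: "(X ** skew_part (N ** transpose X ** W)) \<bullet> Z =
        W \<bullet> (X ** N ** skew_part (transpose X ** Z))"
      by (simp add: inner_matrix_mult_left[of X] inner_skew_part)
        (simp add: inner_matrix_mult_left matrix_expand transpose_N)
    have "transpose (mat 1 - col_proj X) = mat 1 - col_proj X"
      by (simp add: matrix_expand transpose_N)
    then have 2: "((mat 1 - col_proj X) ** W) \<bullet> Z = W \<bullet> ((mat 1 - col_proj X) ** Z)"
      by (metis inner_matrix_mult_left)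
    show ?thesis
      by (simp add: proj_tangent_def inner_add_left inner_add_right 1 2)
  qed
  then have "adjoint (proj_tangent X) =
      (\<lambda>W. X ** skew_part (N ** transpose X ** W) + (mat 1 - col_proj X) ** W)"
    by (intro adjoint_unique) (metis inner_commute)
  then show ?thesis by simp
qed

lemma adjoint_proj_normal:
  "adjoint (proj_normal X) W = X ** sym_part (N ** transpose X ** W)"
proof -
  have "(X ** sym_part (N ** transpose X ** W)) \<bullet> Z = W \<bullet> proj_normal X Z" for W Z
    by (simp add: inner_matrix_mult_left[of X] inner_sym_part proj_normal_def)
      (simp add: inner_matrix_mult_left matrix_expand transpose_N)
  then have "adjoint (proj_normal X) = (\<lambda>W. X ** sym_part (N ** transpose X ** W))"
    by (intro adjoint_unique) (metis inner_commute)
  then show ?thesis by simp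
qed

lemma proj_tangent_in: "proj_tangent X Z \<in> tangent_St X"
proof -
  have "transpose X ** proj_tangent X Z = skew_part (transpose X ** Z)"
    by (simp add: proj_tangent_def matrix_simps)
  then show ?thesis by (simp add: tangent_St_iff)
qed

lemma proj_tangent_id: "\<xi> \<in> tangent_St X \<Longrightarrow> proj_tangent X \<xi> = \<xi>"
  by (simp add: tangent_St_iff proj_tangent_def skew_part_Skew matrix_simps)

lemma normal_St_iff: "\<xi> \<in> normal_St X \<longleftrightarrow> proj_normal X \<xi> = \<xi>"
proof
  assume "\<xi> \<in> normal_St X"
  then show "proj_normal X \<xi> = \<xi>"
    by (auto simp: normal_St_def proj_normal_def matrix_simps sym_part_Sym)
qed (metis (mono_tags, lifting) mem_Collect_eq normal_St_def proj_normal_def sym_part_in_Sym_mats)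

text \<open>Moving X M^-1 across the inner product turns orthogonality to the normal space into
  orthogonality of M^-1 X^T W to every symmetric matrix.\<close>

lemma orthogonal_comp_normal_iff:
  "W \<in> orthogonal_comp (normal_St X) \<longleftrightarrow> N ** transpose X ** W \<in> Skew_mats"
proof -
  have "W \<in> orthogonal_comp (normal_St X) \<longleftrightarrow> (\<forall>S\<in>Sym_mats. (X ** N ** S) \<bullet> W = 0)"
    by (auto simp: orthogonal_comp_def orthogonal_def normal_St_def)
  also have "\<dots> \<longleftrightarrow> N ** transpose X ** W \<in> Skew_mats"
    unfolding Skew_mats_iff_orthogonal_Sym
    by (simp add: inner_matrix_mult_left matrix_expand transpose_N)
  finally show ?thesis .
qed

lemma orthogonal_comp_normal:
  "orthogonal_comp (normal_St X) =
    {X ** \<Omega> + \<Delta> | \<Omega> \<Delta>. \<Omega> \<in> Skew_mats \<and> transpose \<Delta> ** X = 0}"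
proof (intro set_eqI iffI)
  fix W assume "W \<in> orthogonal_comp (normal_St X)"
  then have "N ** transpose X ** W \<in> Skew_mats"
    by (simp add: orthogonal_comp_normal_iff)
  \<comment> \<open>The splitting is W = P W + (I - P) W, with P W = X (M^-1 X^T W).\<close>
  moreover have "W = X ** (N ** transpose X ** W) + (W - col_proj X ** W)"
    by (simp add: matrix_expand)
  moreover have "transpose (W - col_proj X ** W) ** X = 0"
    by (simp add: matrix_simps)
  ultimately show "W \<in> {X ** \<Omega> + \<Delta> | \<Omega> \<Delta>. \<Omega> \<in> Skew_mats \<and> transpose \<Delta> ** X = 0}"
    by blast
next
  fix W assume "W \<in> {X ** \<Omega> + \<Delta> | \<Omega> \<Delta>. \<Omega> \<in> Skew_mats \<and> transpose \<Delta> ** X = 0}"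
  then obtain \<Omega> \<Delta> where W: "W = X ** \<Omega> + \<Delta>" and \<Omega>: "\<Omega> \<in> Skew_mats"
    and \<Delta>: "transpose \<Delta> ** X = 0"
    by auto
  have "transpose X ** \<Delta> = 0"
    using arg_cong[OF \<Delta>, of transpose] by (simp add: matrix_expand)
  then show "W \<in> orthogonal_comp (normal_St X)"
    by (simp add: orthogonal_comp_normal_iff W \<Omega> matrix_simps)
qed

lemma orthogonal_comp_tangent: "orthogonal_comp (tangent_St X) = {X ** S | S. S \<in> Sym_mats}"
proof (intro set_eqI iffI)
  fix W assume W: "W \<in> orthogonal_comp (tangent_St X)"
  \<comment> \<open>As the projector maps into the tangent space, its adjoint annihilates every W
    orthogonal to that space. The adjoint is also W \<mapsto> W - X sym(M^-1 X^T W), so W has the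
    form X S.\<close>
  have "adjoint (proj_tangent X) W \<bullet> Z = 0 \<bullet> Z" for Z
  proof -
    have "linear (proj_tangent X)"
      by (rule linearI)
        (simp_all add: proj_tangent_def skew_part_def matrix_expand algebra_simps)
    then have "adjoint (proj_tangent X) W \<bullet> Z = W \<bullet> proj_tangent X Z"
      by (metis adjoint_works inner_commute)
    also have "\<dots> = 0"
      using W proj_tangent_in[of Z]
      by (auto simp: orthogonal_comp_def orthogonal_def inner_commute)
    finally show ?thesis by simp
  qed
  then have "adjoint (proj_tangent X) W = 0"
    by (rule inner_left_cancel)
  moreover have "adjoint (proj_tangent X) W = W - X ** sym_part (N ** transpose X ** W)"
    using sym_part_add_skew_part[of "N ** transpose X ** W"]
    by (simp add: adjoint_proj_tangent eq_diff_eq[symmetric] matrix_expand)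
  ultimately have "W = X ** sym_part (N ** transpose X ** W)"
    by simp
  then show "W \<in> {X ** S | S. S \<in> Sym_mats}"
    by (metis (mono_tags, lifting) mem_Collect_eq sym_part_in_Sym_mats)
next
  fix W assume "W \<in> {X ** S | S. S \<in> Sym_mats}"
  then show "W \<in> orthogonal_comp (tangent_St X)"
    by (auto simp: orthogonal_comp_def orthogonal_def tangent_St_iff inner_commute[of _ "X ** _"]
        inner_matrix_mult_left inner_Sym_Skew)
qed

section \<open>The operator representing the metric and its inverse\<close>

definition metric_op :: "real^'p^'n \<Rightarrow> real^'p^'n"
  where "metric_op W = (mat 1 - (1 - \<beta>) *\<^sub>R col_proj X) ** W ** N"

definition metric_op_inv :: "real^'p^'n \<Rightarrow> real^'p^'n"
  where "metric_op_inv W =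
    (1 / \<beta>) *\<^sub>R (col_proj X ** W ** gram X) + (mat 1 - col_proj X) ** W ** gram X"

text \<open>P and I - P are complementary projections, and I - (1 - \<beta>) P = (I - P) + \<beta>
  P. The factors \<beta> and 1/\<beta> cancel on the range of P, and M cancels M^-1 on the
  right.\<close>

lemma metric_op_metric_op_inv: "metric_op (metric_op_inv W) = W"
  using beta_pos by (simp add: metric_op_def metric_op_inv_def matrix_simps vec_eq_iff field_simps)

lemma metric_op_inv_metric_op: "metric_op_inv (metric_op W) = W"
  using beta_pos by (simp add: metric_op_def metric_op_inv_def matrix_simps vec_eq_iff field_simps)

lemma beta_metric_eq_right: "beta_metric \<beta> X \<xi> \<zeta> = metric_op \<zeta> \<bullet> \<xi>"
  by (simp add: beta_metric_def metric_op_def)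

text \<open>Symmetry of the metric: the left factor I - (1 - \<beta>) P and the right factor M^-1 of
  \<open>metric_op\<close> are both symmetric matrices.\<close>

lemma beta_metric_eq_left: "beta_metric \<beta> X \<xi> \<zeta> = metric_op \<xi> \<bullet> \<zeta>"
proof -
  have K: "transpose (mat 1 - (1 - \<beta>) *\<^sub>R col_proj X) = mat 1 - (1 - \<beta>) *\<^sub>R col_proj X"
    by (simp add: matrix_expand transpose_N)
  have "metric_op \<zeta> \<bullet> \<xi> = \<zeta> \<bullet> metric_op \<xi>"
    by (simp only: metric_op_def inner_matrix_mult_right[of _ N] inner_matrix_mult_left[of _ \<zeta>] K
        transpose_N matrix_mul_assoc)
  then show ?thesis
    by (simp add: beta_metric_eq_right inner_commute)
qed

lemma metric_op_inv_mult: "metric_op_inv (X ** A) = (1 / \<beta>) *\<^sub>R (X ** A ** gram X)"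
  by (simp add: metric_op_inv_def matrix_simps)

section \<open>Inverses of the sandwiched operators\<close>

lemma G_T_tilde_eq:
  assumes "\<xi> \<in> tangent_St X"
  shows "G_T_tilde \<beta> X \<xi> = metric_op \<xi>" and "metric_op \<xi> \<in> orthogonal_comp (normal_St X)"
proof -
  have G: "G_T \<beta> X \<xi> = metric_op \<xi>"
    by (simp add: G_T_def metric_op_def matrix_expand algebra_simps)
  \<comment> \<open>Up to the factor \<beta> this is a congruence of the skew matrix X^T \<xi> by
    the symmetric M^-1, hence skew. The adjoint projector therefore fixes
    \<open>metric_op \<xi>\<close>.\<close>
  have eq: "N ** transpose X ** metric_op \<xi> = \<beta> *\<^sub>R (N ** (transpose X ** \<xi>) ** N)"
    by (simp add: metric_op_def matrix_simps algebra_simps)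
  have skew: "N ** transpose X ** metric_op \<xi> \<in> Skew_mats"
    using assms unfolding eq tangent_St_iff Skew_mats_def
    by (simp add: matrix_transpose_mul transpose_N transpose_scalar)
       (simp add: matrix_expand)
  then show "metric_op \<xi> \<in> orthogonal_comp (normal_St X)"
    by (simp add: orthogonal_comp_normal_iff)
  show "G_T_tilde \<beta> X \<xi> = metric_op \<xi>"
    by (simp add: G_T_tilde_def proj_tangent_id[OF assms] G adjoint_proj_tangent
        skew_part_Skew[OF skew])
       (simp add: matrix_expand)
qed

lemma metric_op_inv_in_tangent:
  assumes "W \<in> orthogonal_comp (normal_St X)"
  shows "metric_op_inv W \<in> tangent_St X"
proof -
  obtain \<Omega> where \<Omega>: "\<Omega> = N ** transpose X ** W" "\<Omega> \<in> Skew_mats"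
    using assms by (simp add: orthogonal_comp_normal_iff)
  \<comment> \<open>X^T annihilates the I - P summand, and what remains is a congruence of the skew
    matrix \<Omega> by M.\<close>
  have "transpose X ** metric_op_inv W = (1 / \<beta>) *\<^sub>R (gram X ** \<Omega> ** gram X)"
    by (simp add: metric_op_inv_def \<Omega>(1) matrix_simps)
  then show ?thesis
    using \<Omega>(2) by (simp add: tangent_St_iff Skew_mats_def matrix_expand)
qed

lemma bij_betw_G_T_tilde:
  "bij_betw (G_T_tilde \<beta> X) (tangent_St X) (orthogonal_comp (normal_St X))"
  by (rule bij_betw_byWitness[where f' = metric_op_inv])
    (auto simp: G_T_tilde_eq metric_op_inv_in_tangent metric_op_metric_op_inv
      metric_op_inv_metric_op)

lemma inv_G_T_tilde:
  "W \<in> orthogonal_comp (normal_St X) \<Longrightarrow>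
    the_inv_into (tangent_St X) (G_T_tilde \<beta> X) W = metric_op_inv W"
  by (rule the_inv_into_f_eq[OF bij_betw_imp_inj_on[OF bij_betw_G_T_tilde]])
    (auto simp: G_T_tilde_eq metric_op_inv_in_tangent metric_op_metric_op_inv)

lemma inv_G_T_tilde_apply:
  assumes "\<Omega> \<in> Skew_mats" "transpose \<Delta> ** X = 0"
  shows "the_inv_into (tangent_St X) (G_T_tilde \<beta> X) (X ** \<Omega> + \<Delta>) =
    (1 / \<beta>) *\<^sub>R (X ** \<Omega> ** gram X) + \<Delta> ** gram X"
proof -
  have "transpose X ** \<Delta> = 0"
    using arg_cong[OF assms(2), of transpose] by (simp add: matrix_expand)
  \<comment> \<open>The generality in \<open>A\<close> matches the right-associated normal form, in
    which \<Delta> is always followed by another factor.\<close>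
  then have "transpose X ** (\<Delta> ** A) = 0" for A :: "real^'p^'p"
    by (simp add: matrix_mul_assoc matrix_mult_zero_left)
  then have "metric_op_inv (X ** \<Omega> + \<Delta>) = (1 / \<beta>) *\<^sub>R (X ** \<Omega> ** gram X) + \<Delta> ** gram X"
    by (simp add: metric_op_inv_def matrix_simps)
  moreover have "X ** \<Omega> + \<Delta> \<in> orthogonal_comp (normal_St X)"
    using assms unfolding orthogonal_comp_normal by blast
  ultimately show ?thesis
    by (simp add: inv_G_T_tilde)
qed

text \<open>P fixes X, so \<open>G_N\<close> yields \<beta> X M^-1 S M^-1; the matrix M^-1 S M^-1 is
  symmetric and survives the symmetric part in the adjoint projector.\<close>

lemma G_N_tilde_mult:
  assumes "S \<in> Sym_mats"
  shows "G_N_tilde \<beta> X (X ** N ** S) = \<beta> *\<^sub>R (X ** (N ** S ** N))"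
proof -
  have "N ** S ** N \<in> Sym_mats"
    using assms by (simp add: Sym_mats_def matrix_expand transpose_N)
  moreover have "X ** N ** S \<in> normal_St X"
    using assms by (auto simp: normal_St_def)
  ultimately show ?thesis
    by (simp add: G_N_tilde_def normal_St_iff adjoint_proj_normal G_N_def)
       (simp add: matrix_simps Sym_mats_def sym_part_def flip: scaleR_2)
qed

lemma G_N_tilde_eq_metric_op:
  assumes "\<xi> \<in> normal_St X"
  shows "G_N_tilde \<beta> X \<xi> = metric_op \<xi>" and "metric_op \<xi> \<in> orthogonal_comp (tangent_St X)"
proof -
  obtain S where S: "\<xi> = X ** N ** S" "S \<in> Sym_mats"
    using assms by (auto simp: normal_St_def)
  have eq: "metric_op \<xi> = X ** (\<beta> *\<^sub>R (N ** S ** N))"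
    by (simp add: metric_op_def S(1) matrix_simps algebra_simps)
  then show "G_N_tilde \<beta> X \<xi> = metric_op \<xi>"
    by (simp add: S G_N_tilde_mult matrix_mult_scaleR_right)
  have "\<beta> *\<^sub>R (N ** S ** N) \<in> Sym_mats"
    using S(2) by (simp add: Sym_mats_def matrix_expand transpose_N)
  then show "metric_op \<xi> \<in> orthogonal_comp (tangent_St X)"
    unfolding eq orthogonal_comp_tangent by blast
qed

lemma metric_op_inv_in_normal:
  assumes "W \<in> orthogonal_comp (tangent_St X)"
  shows "metric_op_inv W \<in> normal_St X"
proof -
  obtain S where S: "W = X ** S" "S \<in> Sym_mats"
    using assms by (auto simp: orthogonal_comp_tangent)
  \<comment> \<open>Inserting M^-1 M after X brings (1/\<beta>) X S M into the shape of a normal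
    vector.\<close>
  have "metric_op_inv W = X ** N ** ((1 / \<beta>) *\<^sub>R (gram X ** S ** gram X))"
    by (simp add: S(1) metric_op_inv_mult matrix_simps)
  moreover have "(1 / \<beta>) *\<^sub>R (gram X ** S ** gram X) \<in> Sym_mats"
    using S(2) by (simp add: Sym_mats_def matrix_expand)
  ultimately show ?thesis
    unfolding normal_St_def by blast
qed

lemma bij_betw_G_N_tilde:
  "bij_betw (G_N_tilde \<beta> X) (normal_St X) (orthogonal_comp (tangent_St X))"
  by (rule bij_betw_byWitness[where f' = metric_op_inv])
    (auto simp: G_N_tilde_eq_metric_op metric_op_inv_in_normal metric_op_metric_op_inv
      metric_op_inv_metric_op)

lemma inv_G_N_tilde_apply:
  assumes "S \<in> Sym_mats"
  shows "the_inv_into (normal_St X) (G_N_tilde \<beta> X) (X ** S) =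
    (1 / \<beta>) *\<^sub>R (X ** S ** gram X)"
proof -
  have "X ** S \<in> orthogonal_comp (tangent_St X)"
    using assms unfolding orthogonal_comp_tangent by blast
  then have "the_inv_into (normal_St X) (G_N_tilde \<beta> X) (X ** S) = metric_op_inv (X ** S)"
    by (intro the_inv_into_f_eq[OF bij_betw_imp_inj_on[OF bij_betw_G_N_tilde]])
      (auto simp: G_N_tilde_eq_metric_op metric_op_inv_in_normal metric_op_metric_op_inv)
  then show ?thesis by (simp add: metric_op_inv_mult)
qed

section \<open>Gradients with respect to the metric\<close>

lemma tangent_eq_zero_if_beta_orthogonal:
  assumes "\<eta> \<in> tangent_St X" and "\<And>\<xi>. \<xi> \<in> tangent_St X \<Longrightarrow> beta_metric \<beta> X \<eta> \<xi> = 0"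
  shows "\<eta> = 0"
proof -
  \<comment> \<open>Orthogonality to the tangent space makes \<eta> a normal vector. It is also
    tangent, so X^T \<eta> is skew and the symmetric matrix defining \<eta> vanishes.\<close>
  have "metric_op \<eta> \<in> orthogonal_comp (tangent_St X)"
    using assms(2) by (auto simp: orthogonal_comp_def orthogonal_def beta_metric_eq_left inner_commute)
  moreover have "metric_op_inv (metric_op \<eta>) = \<eta>" by (rule metric_op_inv_metric_op)
  ultimately have "\<eta> \<in> normal_St X"
    using metric_op_inv_in_normal by metis
  then have "\<eta> = X ** N ** sym_part (transpose X ** \<eta>)"
    by (simp add: normal_St_iff proj_normal_def)
  also have "sym_part (transpose X ** \<eta>) = 0"
    using assms(1) by (simp add: tangent_St_iff sym_part_def Skew_mats_def)
  finally show ?thesis by (simp add: matrix_expand)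
qed

lemma riem_grad_St_eq:
  assumes "(f has_derivative D) (at X)"
  shows "riem_grad_St (beta_metric \<beta>) f X = metric_op_inv (adjoint (proj_tangent X) (frob_grad f X))"
proof -
  let ?F = "frob_grad f X"
  let ?W = "adjoint (proj_tangent X) ?F"
  have D: "frechet_derivative f (at X) = (\<lambda>\<xi>. \<xi> \<bullet> ?F)"
    by (rule trans[OF frechet_derivative_at[OF assms, symmetric] frob_grad_works[OF assms]])
  \<comment> \<open>The Frobenius gradient splits into ?W, which lies in the complement of the
    normal space, and a term X S that tangent vectors do not see. Thus ?W represents the derivative
    on the tangent space, and its image under \<open>metric_op_inv\<close> is tangent.\<close>
  have split: "?F = ?W + X ** sym_part (N ** transpose X ** ?F)"
    using sym_part_add_skew_part[of "N ** transpose X ** ?F"]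
    by (simp add: adjoint_proj_tangent eq_diff_eq[symmetric] matrix_expand)
  have "N ** transpose X ** ?W = skew_part (N ** transpose X ** ?F)"
    by (simp add: adjoint_proj_tangent matrix_simps)
  then have "?W \<in> orthogonal_comp (normal_St X)"
    by (simp add: orthogonal_comp_normal_iff)
  then have tan: "metric_op_inv ?W \<in> tangent_St X"
    by (rule metric_op_inv_in_tangent)
  have g: "beta_metric \<beta> X (metric_op_inv ?W) \<xi> = \<xi> \<bullet> ?F" if "\<xi> \<in> tangent_St X" for \<xi>
  proof -
    have "X ** sym_part (N ** transpose X ** ?F) \<in> orthogonal_comp (tangent_St X)"
      unfolding orthogonal_comp_tangent by auto
    then have "\<xi> \<bullet> (X ** sym_part (N ** transpose X ** ?F)) = 0"
      using that by (auto simp: orthogonal_comp_def orthogonal_def)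
    then have "\<xi> \<bullet> ?F = \<xi> \<bullet> ?W"
      by (subst split) (simp add: inner_add_right)
    then show ?thesis
      by (simp add: beta_metric_eq_left metric_op_metric_op_inv inner_commute)
  qed
  show ?thesis
    unfolding riem_grad_St_def D
  proof (rule the_equality)
    show "metric_op_inv ?W \<in> tangent_St X \<and>
        (\<forall>\<xi>\<in>tangent_St X. beta_metric \<beta> X (metric_op_inv ?W) \<xi> = \<xi> \<bullet> ?F)"
      using tan g by blast
  next
    fix \<eta> assume \<eta>: "\<eta> \<in> tangent_St X \<and> (\<forall>\<xi>\<in>tangent_St X. beta_metric \<beta> X \<eta> \<xi> = \<xi> \<bullet> ?F)"
    have "\<eta> - metric_op_inv ?W \<in> tangent_St X"
      using \<eta> tan by (simp add: tangent_St_iff Skew_mats_def matrix_expand)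
    moreover have "beta_metric \<beta> X (\<eta> - metric_op_inv ?W) \<xi> = 0" if "\<xi> \<in> tangent_St X" for \<xi>
      using that \<eta> g[OF that] by (simp add: beta_metric_eq_right inner_diff_right)
    ultimately have "\<eta> - metric_op_inv ?W = 0"
      by (rule tangent_eq_zero_if_beta_orthogonal)
    then show "\<eta> = metric_op_inv ?W" by simp
  qed
qed

lemma metric_grad_eq:
  assumes "(f has_derivative (\<lambda>\<xi>. G \<bullet> \<xi>)) (at X)"
  shows "metric_grad (beta_metric \<beta>) f X = metric_op_inv G"
  unfolding metric_grad_def frechet_derivative_at[OF assms, symmetric]
proof (rule the_equality)
  show "\<forall>\<xi>. beta_metric \<beta> X (metric_op_inv G) \<xi> = G \<bullet> \<xi>"
    by (simp add: beta_metric_eq_left metric_op_metric_op_inv)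
next
  fix \<eta> assume "\<forall>\<xi>. beta_metric \<beta> X \<eta> \<xi> = G \<bullet> \<xi>"
  then have "metric_op \<eta> = G"
    by - (rule inner_left_cancel, simp add: beta_metric_eq_left)
  then show "\<eta> = metric_op_inv G"
    using metric_op_inv_metric_op[of \<eta>] by simp
qed

section \<open>The adjoint of the constraint derivative and the landing directions\<close>

lemma D_constr_adj_eq:
  "D_constr_adj (beta_metric \<beta>) X S = (1 / \<beta>) *\<^sub>R (X ** sym_part S ** gram X)"
proof -
  \<comment> \<open>\<open>S\<close> is arbitrary here; since Dc(X) has symmetric values, only the
    symmetric part of \<open>S\<close> matters.\<close>
  have D: "D_constr X \<xi> \<bullet> S = (X ** sym_part S) \<bullet> \<xi>" for \<xi>
    by (simp add: D_constr_eq inner_mult_sym_part inner_commute[of _ S])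
  have "D_constr_adj (beta_metric \<beta>) X S = metric_op_inv (X ** sym_part S)"
    unfolding D_constr_adj_def D beta_metric_eq_right
  proof (rule the_equality)
    fix \<eta> assume "\<forall>\<xi>. (X ** sym_part S) \<bullet> \<xi> = metric_op \<eta> \<bullet> \<xi>"
    then have "X ** sym_part S = metric_op \<eta>"
      by - (rule inner_left_cancel, simp)
    then show "\<eta> = metric_op_inv (X ** sym_part S)"
      by (simp add: metric_op_inv_metric_op)
  qed (simp add: metric_op_metric_op_inv)
  then show ?thesis by (simp add: metric_op_inv_mult)
qed

lemma H_op_eq:
  assumes "S \<in> Sym_mats"
  shows "H_op (beta_metric \<beta>) X S = (1 / \<beta>) *\<^sub>R (gram X ** S ** gram X)"
proof -
  have "H_op (beta_metric \<beta>) X S = sym_part ((1 / \<beta>) *\<^sub>R (gram X ** S ** gram X))"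
    by (simp add: H_op_def D_constr_eq D_constr_adj_eq sym_part_Sym[OF assms] matrix_expand)
  also have "\<dots> = (1 / \<beta>) *\<^sub>R (gram X ** S ** gram X)"
    using assms by (intro sym_part_Sym) (simp add: Sym_mats_def matrix_expand)
  finally show ?thesis .
qed

text \<open>H(X) acts as S \<mapsto> (1/\<beta>) M S M, which T \<mapsto> \<beta> M^-1 T M^-1
  undoes. Injectivity is what lets the pseudoinverse cancel H(X) on symmetric matrices.\<close>

lemma inj_on_H_op: "inj_on (H_op (beta_metric \<beta>) X) Sym_mats"
proof (rule inj_on_inverseI)
  fix S :: "real^'p^'p" assume "S \<in> Sym_mats"
  then show "\<beta> *\<^sub>R (N ** H_op (beta_metric \<beta>) X S ** N) = S"
    using beta_pos by (simp add: H_op_eq matrix_simps)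
qed

text \<open>The inverse of H(X) cancels H(X) at the symmetric matrix c(X), leaving minus the metric
  adjoint of Dc(X) at c(X). In this form it is visibly the metric gradient of the penalty up to
  sign, X c(X) being the Frobenius gradient.\<close>

lemma landing_N_eq: "landing_N \<beta> X = - metric_op_inv (X ** constr X)"
  by (simp add: landing_N_def D_constr_pinv_def the_inv_into_f_f[OF inj_on_H_op]
      constr_in_Sym_mats D_constr_adj_eq sym_part_Sym metric_op_inv_mult)

lemma landing_T_eq:
  assumes "(f has_derivative D) (at X)"
  shows "landing_T \<beta> f X =
    - (1 / \<beta>) *\<^sub>R (X ** skew_part (N ** transpose X ** frob_grad f X) ** gram X)
    - (mat 1 - col_proj X) ** frob_grad f X ** gram X"
  by (simp add: landing_T_def riem_grad_St_eq[OF assms] adjoint_proj_tangent metric_op_inv_def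
      matrix_simps)

text \<open>With G the Frobenius gradient, expanding the skew part gives (P G M - X G^T X)/2, as
  M^-1 cancels M in the transposed term. The multiples of P G M then combine to 1 -
  1/(2\<beta>).\<close>

lemma landing_T_eq':
  assumes "(f has_derivative D) (at X)"
  shows "landing_T \<beta> f X =
    - (frob_grad f X ** gram X)
    + (1 / (2 * \<beta>)) *\<^sub>R (X ** transpose (frob_grad f X) ** X)
    - (1 / (2 * \<beta>) - 1) *\<^sub>R (col_proj X ** frob_grad f X ** gram X)"
  using beta_pos
  by (simp add: landing_T_eq[OF assms] skew_part_def matrix_simps vec_eq_iff field_simps)

end

theorem proposition7p14:
  fixes X :: "real^'p^'n" and \<beta> :: real
  assumes beta_pos: "\<beta> > 0"
    and p_le_n: "CARD('p) \<le> CARD('n)"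
    and full_rank: "rank X = CARD('p)"
  shows
    "bij_betw (G_T_tilde \<beta> X) (tangent_St X) (orthogonal_comp (normal_St X)) \<and>
     orthogonal_comp (normal_St X) =
       {X ** \<Omega> + \<Delta> | \<Omega> \<Delta>. \<Omega> \<in> Skew_mats \<and> transpose \<Delta> ** X = 0} \<and>
     (\<forall>\<Omega>\<in>Skew_mats. \<forall>\<Delta> :: real^'p^'n. transpose \<Delta> ** X = 0 \<longrightarrow>
       the_inv_into (tangent_St X) (G_T_tilde \<beta> X) (X ** \<Omega> + \<Delta>) =
         (1 / \<beta>) *\<^sub>R (X ** \<Omega> ** gram X) + \<Delta> ** gram X) \<and>
     bij_betw (G_N_tilde \<beta> X) (normal_St X) (orthogonal_comp (tangent_St X)) \<and>
     orthogonal_comp (tangent_St X) = {X ** S | S. S \<in> Sym_mats} \<and>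
     (\<forall>S\<in>Sym_mats.
       the_inv_into (normal_St X) (G_N_tilde \<beta> X) (X ** S) = (1 / \<beta>) *\<^sub>R (X ** S ** gram X)) \<and>
     (\<forall>f :: real^'p^'n \<Rightarrow> real. cont_differentiable f \<longrightarrow>
       landing_T \<beta> f X =
         - (1 / \<beta>) *\<^sub>R
             (X ** skew_part (matrix_inv (gram X) ** transpose X ** frob_grad f X) ** gram X)
         - (mat 1 - col_proj X) ** frob_grad f X ** gram X \<and>
       landing_T \<beta> f X =
         - (frob_grad f X ** gram X)
         + (1 / (2 * \<beta>)) *\<^sub>R (X ** transpose (frob_grad f X) ** X)
         - (1 / (2 * \<beta>) - 1) *\<^sub>R (col_proj X ** frob_grad f X ** gram X)) \<and>
     landing_N \<beta> X = - metric_grad (beta_metric \<beta>) penalty X \<and>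
     landing_N \<beta> X = - (1 / (2 * \<beta>)) *\<^sub>R (X ** (gram X - mat 1) ** gram X)"
proof -
  interpret full_column_rank X \<beta>
    using full_rank beta_pos by unfold_locales
  have deriv: "(f has_derivative frechet_derivative f (at X)) (at X)"
    if f: "cont_differentiable f" for f :: "real^'p^'n \<Rightarrow> real"
    using f unfolding cont_differentiable_def
    by (metis differentiableI frechet_derivative_works)
  have N1: "landing_N \<beta> X = - metric_grad (beta_metric \<beta>) penalty X"
    by (simp add: landing_N_eq metric_grad_eq[OF has_derivative_penalty])
  have N2: "landing_N \<beta> X = - (1 / (2 * \<beta>)) *\<^sub>R (X ** (gram X - mat 1) ** gram X)"
    by (simp add: landing_N_eq metric_op_inv_mult)
      (simp add: constr_def matrix_expand scaleR_diff_right mult.commute)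
  show ?thesis
    by (intro conjI allI ballI impI bij_betw_G_T_tilde orthogonal_comp_normal
        inv_G_T_tilde_apply bij_betw_G_N_tilde orthogonal_comp_tangent inv_G_N_tilde_apply
        landing_T_eq[OF deriv] landing_T_eq'[OF deriv] N1 N2)
qed

end
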